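(* Let $A$ be a unital $C^{*}$-algebra and let $x \in A_{sa}$. Then the following two conditions are equivalent: \begin{itemize} \item $\sigma(xy) \subset \mathbb{R}$ for every $y \in A_{sa}$; \item $x_{+}yx_{-}=0$ for every $y \in A$. \end{itemize}
   Context: $C^*$-algebras are complex. $A_{sa}$ denotes the set of all self-adjoint elements of $A$, and $\sigma(\cdot)$ denotes the spectrum of an element of $A$. For $x\in A_{sa}$, $x=x_{+}-x_{-}$ denotes the decomposition of $x$ into its positive and negative parts, i.e. $x_+,x_-\ge 0$ and $x_{+}x_{-}=x_{-}x_{+}=0$. *)

theory Defs
  imports Complex_Main
begin

text \<open>
  The library only has real normed algebras, so the complex structure is added on top of
  them. The real scalar multiplication is required to be the restriction of the complex one.
\<close>

class complex_banach_algebra_1 = real_normed_algebra_1 + banach +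
  fixes scaleC :: "complex \<Rightarrow> 'a \<Rightarrow> 'a"  (infixr \<open>*\<^sub>C\<close> 75)
  assumes scaleR_scaleC: "r *\<^sub>R x = complex_of_real r *\<^sub>C x"
    and scaleC_add_right: "c *\<^sub>C (x + y) = c *\<^sub>C x + c *\<^sub>C y"
    and scaleC_add_left: "(c + d) *\<^sub>C x = c *\<^sub>C x + d *\<^sub>C x"
    and scaleC_scaleC: "c *\<^sub>C (d *\<^sub>C x) = (c * d) *\<^sub>C x"
    and scaleC_one: "1 *\<^sub>C x = x"
    and mult_scaleC_left: "(c *\<^sub>C x) * y = c *\<^sub>C (x * y)"
    and mult_scaleC_right: "x * (c *\<^sub>C y) = c *\<^sub>C (x * y)"
    and norm_scaleC: "norm (c *\<^sub>C x) = cmod c * norm x"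

class unital_cstar_algebra = complex_banach_algebra_1 +
  fixes adj :: "'a \<Rightarrow> 'a"
  assumes adj_adj: "adj (adj x) = x"
    and adj_add: "adj (x + y) = adj x + adj y"
    and adj_scaleC: "adj (c *\<^sub>C x) = cnj c *\<^sub>C adj x"
    and adj_mult: "adj (x * y) = adj y * adj x"
    and cstar_identity: "norm (adj x * x) = (norm x)\<^sup>2"

definition two_sided_unit :: "'a::monoid_mult \<Rightarrow> bool" where
  "two_sided_unit a \<longleftrightarrow> (\<exists>b. a * b = 1 \<and> b * a = 1)"

definition alg_spectrum :: "'a::complex_banach_algebra_1 \<Rightarrow> complex set" where
  "alg_spectrum a = {c. \<not> two_sided_unit (a - c *\<^sub>C 1)}"

definition self_adjoint :: "'a::unital_cstar_algebra \<Rightarrow> bool" where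
  "self_adjoint a \<longleftrightarrow> adj a = a"

definition positive_elem :: "'a::unital_cstar_algebra \<Rightarrow> bool" where
  "positive_elem a \<longleftrightarrow> self_adjoint a \<and> alg_spectrum a \<subseteq> complex_of_real ` {0..}"

definition pos_neg_decomp ::
  "'a::unital_cstar_algebra \<Rightarrow> 'a \<Rightarrow> 'a \<Rightarrow> bool" where
  "pos_neg_decomp x p q \<longleftrightarrow>
     positive_elem p \<and> positive_elem q \<and> x = p - q \<and> p * q = 0 \<and> q * p = 0"

text \<open>
  Every self-adjoint element has exactly one such decomposition, so the descriptions
  below are proper on self-adjoint elements; elsewhere their values are irrelevant.
\<close>

definition pos_part :: "'a::unital_cstar_algebra \<Rightarrow> 'a" where
  "pos_part x = (THE p. \<exists>q. pos_neg_decomp x p q)"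

definition neg_part :: "'a::unital_cstar_algebra \<Rightarrow> 'a" where
  "neg_part x = (THE q. \<exists>p. pos_neg_decomp x p q)"

end

theory Submission
  imports Defs "HOL-Analysis.Topology_Euclidean_Space"
begin

text \<open>
  If \<open>p z q = 0\<close> for all \<open>z\<close>, where \<open>p\<close>, \<open>q\<close> are the positive and negative parts of \<open>x\<close>,
  then \<open>x y\<close> is the sum of the orthogonal elements \<open>p y\<close> and \<open>- q y\<close>, and the nonzero
  spectrum of \<open>p y\<close> is that of the self-adjoint element \<open>r y r\<close> with \<open>r\<close> the square root
  of \<open>p\<close>.

  Conversely, let \<open>v = p z q\<close>. Since \<open>v\<^sup>2 = 0\<close>, the element \<open>v v\<^sup>*\<close> is an orthogonal summand
  of \<open>(v + v\<^sup>*)\<^sup>2\<close>, so its spectrum is nonnegative. With \<open>s\<close> the square root of \<open>q\<close>,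
  \<open>w = r z s\<close> and \<open>y = w + w\<^sup>*\<close>, the element \<open>- (x y)\<^sup>2\<close> has \<open>p w q w\<^sup>*\<close> as an orthogonal
  summand, whose nonzero spectrum is again that of \<open>v v\<^sup>*\<close>. If the spectrum of \<open>x y\<close> is real,
  the spectrum of \<open>v v\<^sup>*\<close> is therefore also nonpositive, and so \<open>v = 0\<close>.
\<close>

section \<open>Units and spectra\<close>

lemma two_sided_unitI:
  assumes "a * b = 1" "c * a = 1"
  shows "two_sided_unit a"
proof -
  have "b = c" using assms by (metis mult.assoc mult_1_left mult_1_right)
  then show ?thesis using assms unfolding two_sided_unit_def by blast
qed

lemma two_sided_unit_one: "two_sided_unit 1"
  by (rule two_sided_unitI[of _ 1 1]) auto

lemma two_sided_unit_mult:
  assumes "two_sided_unit a" "two_sided_unit b"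
  shows "two_sided_unit (a * b)"
proof -
  obtain a' b' where "a * a' = 1" "a' * a = 1" "b * b' = 1" "b' * b = 1"
    using assms unfolding two_sided_unit_def by blast
  then show ?thesis
    by (intro two_sided_unitI[of _ "b' * a'" "b' * a'"]) (metis mult.assoc mult_1_left)+
qed

text \<open>Commutation turns the inverse \<open>z\<close> of the product into a right and a left
  inverse of each factor.\<close>

lemma two_sided_unit_factor:
  assumes "a * b = b * a" "two_sided_unit (a * b)"
  shows "two_sided_unit a" "two_sided_unit b"
proof -
  obtain z where z: "a * b * z = 1" "z * (a * b) = 1"
    using assms unfolding two_sided_unit_def by blast
  show "two_sided_unit a"
    using z assms(1) by (intro two_sided_unitI[of _ "b * z" "z * b"]) (metis mult.assoc)+
  show "two_sided_unit b"
    using z assms(1) by (intro two_sided_unitI[of _ "a * z" "z * a"]) (metis mult.assoc)+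
qed

lemma two_sided_unit_minus:
  fixes a :: "'a::ring_1"
  shows "two_sided_unit (- a) \<longleftrightarrow> two_sided_unit a"
  unfolding two_sided_unit_def by (metis minus_mult_minus minus_minus)

text \<open>Jacobson's lemma: if \<open>u\<close> inverts \<open>1 - a * b\<close>, then
  \<open>1 + b * u * a\<close> inverts \<open>1 - b * a\<close>, as the formal geometric series
  suggests.\<close>

lemma two_sided_unit_one_minus_swap:
  fixes a b :: "'a::ring_1"
  assumes "two_sided_unit (1 - a * b)"
  shows "two_sided_unit (1 - b * a)"
proof -
  obtain u where u: "(1 - a * b) * u = 1" "u * (1 - a * b) = 1"
    using assms unfolding two_sided_unit_def by blast
  have "a * b * u = u - 1" "u * a * b = u - 1" using u by (simp_all add: algebra_simps)
  then have *: "b * (a * (b * (u * a))) = b * (u * a) - b * a" 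
     "b * (u * (a * (b * a))) = b * (u * a) - b * a"
    by (metis left_diff_distrib mult.assoc mult_1_left right_diff_distrib)+
  show ?thesis
    by (rule two_sided_unitI[of _ "1 + b * u * a" "1 + b * u * a"])
      (simp_all add: algebra_simps *)
qed

text \<open>Neumann series: splitting off the first term gives
  \<open>z = 1 + a * z = 1 + z * a\<close>.\<close>

lemma two_sided_unit_one_minus:
  fixes a :: "'a::{real_normed_algebra_1,banach}"
  assumes "norm a < 1"
  shows "two_sided_unit (1 - a)"
proof -
  have s: "summable (\<lambda>n. a ^ n)" using assms by (rule complete_algebra_summable_geometric)
  define z where "z = (\<Sum>n. a ^ n)"
  have "z = 1 + (\<Sum>n. a ^ Suc n)"
    unfolding z_def using suminf_split_head[OF s] by simp
  moreover have "(\<Sum>n. a ^ Suc n) = a * z"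
    unfolding z_def using suminf_mult[OF s, of a] by simp
  moreover have "(\<Sum>n. a ^ Suc n) = z * a"
    unfolding z_def using suminf_mult2[OF s, of a] by (simp add: power_commutes)
  ultimately show ?thesis
    by (intro two_sided_unitI[of _ z z]) (simp_all add: algebra_simps)
qed

section \<open>Complex scalars\<close>

lemma scaleC_zero_left:
  fixes x :: "'a::complex_banach_algebra_1"
  shows "0 *\<^sub>C x = 0"
  using scaleR_scaleC[of 0 x] by simp

lemma scaleC_zero_right: "c *\<^sub>C 0 = (0::'a::complex_banach_algebra_1)"
  using scaleC_add_right[of c "0::'a" 0] by simp

lemma scaleC_minus_left:
  fixes x :: "'a::complex_banach_algebra_1"
  shows "(- c) *\<^sub>C x = - (c *\<^sub>C x)"
  using scaleC_add_left[of c "- c" x] by (simp add: scaleC_zero_left eq_neg_iff_add_eq_0 add.commute)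

lemma scaleC_minus_right:
  fixes x :: "'a::complex_banach_algebra_1"
  shows "c *\<^sub>C (- x) = - (c *\<^sub>C x)"
  using scaleC_add_right[of c x "- x"] by (simp add: scaleC_zero_right eq_neg_iff_add_eq_0 add.commute)

lemma scaleC_diff_left:
  fixes x :: "'a::complex_banach_algebra_1"
  shows "(c - d) *\<^sub>C x = c *\<^sub>C x - d *\<^sub>C x"
  using scaleC_add_left[of c "- d" x] by (simp add: scaleC_minus_left)

lemma scaleC_diff_right:
  fixes x y :: "'a::complex_banach_algebra_1"
  shows "c *\<^sub>C (x - y) = c *\<^sub>C x - c *\<^sub>C y"
  using scaleC_add_right[of c x "- y"] by (simp add: scaleC_minus_right)

lemmas scaleC_simps = scaleC_add_right scaleC_add_left scaleC_diff_left scaleC_diff_right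
  scaleC_minus_left scaleC_minus_right scaleC_scaleC mult_scaleC_left mult_scaleC_right

lemma two_sided_unit_scaleC:
  fixes a :: "'a::complex_banach_algebra_1"
  assumes "c \<noteq> 0" "two_sided_unit a"
  shows "two_sided_unit (c *\<^sub>C a)"
proof -
  obtain z where "a * z = 1" "z * a = 1" using assms unfolding two_sided_unit_def by blast
  then show ?thesis using assms(1)
    by (intro two_sided_unitI[of _ "inverse c *\<^sub>C z" "inverse c *\<^sub>C z"])
      (simp_all add: scaleC_simps scaleC_one)
qed

lemma two_sided_unit_scaleC_iff:
  fixes a :: "'a::complex_banach_algebra_1"
  assumes "c \<noteq> 0"
  shows "two_sided_unit (c *\<^sub>C a) \<longleftrightarrow> two_sided_unit a"
  using two_sided_unit_scaleC[of c a] two_sided_unit_scaleC[of "inverse c" "c *\<^sub>C a"] assms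
  by (auto simp: scaleC_simps scaleC_one)

section \<open>Spectra of products and orthogonal sums\<close>

lemma mem_alg_spectrum: "c \<in> alg_spectrum a \<longleftrightarrow> \<not> two_sided_unit (a - c *\<^sub>C 1)"
  unfolding alg_spectrum_def by simp

lemma alg_spectrum_iff_one_minus:
  fixes a :: "'a::complex_banach_algebra_1"
  assumes "c \<noteq> 0"
  shows "c \<in> alg_spectrum a \<longleftrightarrow> \<not> two_sided_unit (1 - inverse c *\<^sub>C a)"
proof -
  have "(- c) *\<^sub>C (1 - inverse c *\<^sub>C a) = a - c *\<^sub>C 1"
    using assms by (simp add: scaleC_simps scaleC_one)
  then show ?thesis
    using two_sided_unit_scaleC_iff[of "- c" "1 - inverse c *\<^sub>C a"] assms
    by (simp add: mem_alg_spectrum)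
qed

text \<open>Jacobson's lemma with the scalar absorbed in one factor. At \<open>0\<close> the two
  spectra can differ, hence \<open>c \<noteq> 0\<close>.\<close>

lemma alg_spectrum_mult_commute:
  fixes a b :: "'a::complex_banach_algebra_1"
  assumes "c \<noteq> 0"
  shows "c \<in> alg_spectrum (a * b) \<longleftrightarrow> c \<in> alg_spectrum (b * a)"
  using two_sided_unit_one_minus_swap[of "inverse c *\<^sub>C a" b]
    two_sided_unit_one_minus_swap[of b "inverse c *\<^sub>C a"] assms
  by (auto simp: alg_spectrum_iff_one_minus scaleC_simps)

lemma alg_spectrum_norm_le:
  fixes a :: "'a::complex_banach_algebra_1"
  assumes "c \<in> alg_spectrum a"
  shows "cmod c \<le> norm a"
proof (rule ccontr)
  assume *: "\<not> cmod c \<le> norm a"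
  then have c: "c \<noteq> 0" by auto
  have "norm (inverse c *\<^sub>C a) < 1"
    using * c by (simp add: norm_scaleC norm_inverse norm_divide divide_simps)
  then show False
    using two_sided_unit_one_minus assms c by (auto simp: alg_spectrum_iff_one_minus)
qed

lemma alg_spectrum_shift:
  fixes a :: "'a::complex_banach_algebra_1"
  shows "c \<in> alg_spectrum (a + d *\<^sub>C 1) \<longleftrightarrow> c - d \<in> alg_spectrum a"
  by (simp add: mem_alg_spectrum scaleC_simps algebra_simps)

lemma alg_spectrum_minus:
  fixes a :: "'a::complex_banach_algebra_1"
  shows "c \<in> alg_spectrum (- a) \<longleftrightarrow> - c \<in> alg_spectrum a"
proof -
  have "- a - c *\<^sub>C 1 = - (a - (- c) *\<^sub>C 1)" by (simp add: scaleC_simps)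
  then show ?thesis unfolding mem_alg_spectrum by (metis two_sided_unit_minus)
qed

lemma alg_spectrum_scaleC:
  fixes a :: "'a::complex_banach_algebra_1"
  assumes "d \<noteq> 0"
  shows "c \<in> alg_spectrum (d *\<^sub>C a) \<longleftrightarrow> c / d \<in> alg_spectrum a"
proof -
  have "d *\<^sub>C a - c *\<^sub>C 1 = d *\<^sub>C (a - (c / d) *\<^sub>C 1)" using assms by (simp add: scaleC_simps)
  then show ?thesis by (simp add: mem_alg_spectrum two_sided_unit_scaleC_iff assms)
qed

text \<open>Orthogonality gives \<open>(a - c) (b - c) = - c (a + b - c)\<close> with commuting
  factors, and such a product is invertible exactly when both factors are.\<close>

lemma alg_spectrum_add_orthogonal:
  fixes a b :: "'a::complex_banach_algebra_1"
  assumes "a * b = 0" "b * a = 0" "c \<noteq> 0"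
  shows "c \<in> alg_spectrum (a + b) \<longleftrightarrow> c \<in> alg_spectrum a \<or> c \<in> alg_spectrum b"
proof -
  let ?a = "a - c *\<^sub>C 1" and ?b = "b - c *\<^sub>C 1"
  have eq: "?a * ?b = (- c) *\<^sub>C (a + b - c *\<^sub>C 1)" "?b * ?a = ?a * ?b"
    using assms by (simp_all add: scaleC_simps algebra_simps)
  have "two_sided_unit (a + b - c *\<^sub>C 1) \<longleftrightarrow> two_sided_unit (?a * ?b)"
    unfolding eq using assms(3) by (simp add: two_sided_unit_scaleC_iff)
  also have "\<dots> \<longleftrightarrow> two_sided_unit ?a \<and> two_sided_unit ?b"
    using two_sided_unit_mult two_sided_unit_factor[OF eq(2)[symmetric]] by blast
  finally show ?thesis unfolding mem_alg_spectrum by blast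
qed

text \<open>Factor \<open>a * a - c\<close> as \<open>(a - l) (a + l)\<close> with \<open>l\<close>
  a complex square root of \<open>c\<close>: one of \<open>l\<close>, \<open>- l\<close> is a
  spectral value of \<open>a\<close>, so \<open>l\<close> is real.\<close>

lemma alg_spectrum_square_nonneg:
  fixes a :: "'a::complex_banach_algebra_1"
  assumes "alg_spectrum a \<subseteq> \<real>"
  shows "alg_spectrum (a * a) \<subseteq> complex_of_real ` {0..}"
proof
  fix c assume c: "c \<in> alg_spectrum (a * a)"
  define l where "l = csqrt c"
  have l: "l * l = c" unfolding l_def using power2_csqrt[of c] by (simp add: power2_eq_square)
  have "(a - l *\<^sub>C 1) * (a - (- l) *\<^sub>C 1) = a * a - c *\<^sub>C 1"
    by (simp add: scaleC_simps algebra_simps l)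
  then have "l \<in> alg_spectrum a \<or> - l \<in> alg_spectrum a"
    using c two_sided_unit_mult unfolding mem_alg_spectrum by metis
  then have "l \<in> \<real>" using assms by (metis Reals_minus_iff subsetD)
  then obtain r where "l = of_real r" by (auto elim: Reals_cases)
  then have "c = of_real (r * r)" using l by auto
  then show "c \<in> complex_of_real ` {0..}" by (metis atLeast_iff image_eqI zero_le_square)
qed

section \<open>Self-adjoint elements\<close>

lemma adj_zero: "adj (0::'a::unital_cstar_algebra) = 0"
  using adj_add[of "0::'a" 0] by simp

lemma adj_minus:
  fixes x :: "'a::unital_cstar_algebra"
  shows "adj (- x) = - adj x"
  using adj_add[of x "- x"] by (simp add: adj_zero eq_neg_iff_add_eq_0 add.commute)

lemma adj_diff:
  fixes x y :: "'a::unital_cstar_algebra"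
  shows "adj (x - y) = adj x - adj y"
  using adj_add[of x "- y"] by (simp add: adj_minus)

lemma adj_one: "adj (1::'a::unital_cstar_algebra) = 1"
  by (metis adj_adj adj_mult mult_1_left mult_1_right)

lemma adj_scaleR:
  fixes x :: "'a::unital_cstar_algebra"
  shows "adj (r *\<^sub>R x) = r *\<^sub>R adj x"
  by (simp add: scaleR_scaleC adj_scaleC)

text \<open>The C*-identity and submultiplicativity give one inequality for every element; applied
  to \<open>adj x\<close> it gives the other.\<close>

lemma norm_adj:
  fixes x :: "'a::unital_cstar_algebra"
  shows "norm (adj x) = norm x"
proof -
  have le: "norm y \<le> norm (adj y)" for y
  proof (cases "norm y = 0")
    case False
    have "norm y * norm y \<le> norm (adj y) * norm y"
      using cstar_identity[of y] norm_mult_ineq[of "adj y" y] by (simp add: power2_eq_square)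
    then show ?thesis using False by (simp add: mult_le_cancel_right)
  qed simp
  show ?thesis using le[of x] le[of "adj x"] by (simp add: adj_adj)
qed

lemma adj_mult_self_eq_zero:
  fixes x :: "'a::unital_cstar_algebra"
  shows "adj x * x = 0 \<longleftrightarrow> x = 0"
  using cstar_identity[of x] by auto

lemmas adj_simps = adj_adj adj_add adj_mult adj_diff adj_minus adj_one adj_zero adj_scaleR adj_scaleC

lemma tendsto_adj:
  fixes f :: "nat \<Rightarrow> 'a::unital_cstar_algebra"
  assumes "f \<longlonglongrightarrow> l"
  shows "(\<lambda>n. adj (f n)) \<longlonglongrightarrow> adj l"
  using assms unfolding tendsto_iff dist_norm by (simp add: norm_adj flip: adj_diff)

lemma self_adjoint_norm_square:
  fixes a :: "'a::unital_cstar_algebra"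
  assumes "self_adjoint a"
  shows "norm (a * a) = norm a * norm a"
  using cstar_identity[of a] assms by (simp add: self_adjoint_def power2_eq_square)

text \<open>Lets annihilation pass from a positive element to its square root.\<close>

lemma self_adjoint_square_mult_eq_zero:
  fixes a :: "'a::unital_cstar_algebra"
  assumes "self_adjoint a" "a * a * b = 0"
  shows "a * b = 0"
proof -
  have "adj (a * b) * (a * b) = adj b * (a * a * b)"
    using assms(1) by (simp add: self_adjoint_def adj_simps mult.assoc)
  then show ?thesis using assms(2) by (simp add: adj_mult_self_eq_zero)
qed

text \<open>Arens' argument: shifting \<open>a\<close> by \<open>i t\<close> moves a spectral value with imaginary part
  \<open>\<beta>\<close> so that \<open>(\<beta> + t)\<^sup>2 \<le> \<parallel>a + i t\<parallel>\<^sup>2 \<le> \<parallel>a\<parallel>\<^sup>2 + t\<^sup>2\<close>, which fails for suitable \<open>t\<close>.\<close>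

lemma self_adjoint_alg_spectrum_real:
  fixes a :: "'a::unital_cstar_algebra"
  assumes "self_adjoint a"
  shows "alg_spectrum a \<subseteq> \<real>"
proof
  fix c assume c: "c \<in> alg_spectrum a"
  define N where "N = norm (a * a)"
  have bound: "(Im c + t)\<^sup>2 \<le> N + t\<^sup>2" for t :: real
  proof -
    let ?d = "\<i> * complex_of_real t"
    let ?b = "a + ?d *\<^sub>C 1"
    have "c + ?d \<in> alg_spectrum ?b" using c by (simp add: alg_spectrum_shift)
    then have "cmod (c + ?d) \<le> norm ?b" by (rule alg_spectrum_norm_le)
    moreover have "\<bar>Im c + t\<bar> \<le> cmod (c + ?d)" using abs_Im_le_cmod[of "c + ?d"] by simp
    ultimately have "(Im c + t)\<^sup>2 \<le> (norm ?b)\<^sup>2" by (metis abs_le_square_iff abs_norm_cancel order_trans)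
    also have "\<dots> = norm (adj ?b * ?b)" by (simp add: cstar_identity)
    also have "adj ?b * ?b = a * a + complex_of_real (t\<^sup>2) *\<^sub>C 1"
      using assms by (simp add: self_adjoint_def adj_simps scaleC_simps algebra_simps power2_eq_square)
    also have "norm \<dots> \<le> N + t\<^sup>2"
      unfolding N_def by (rule norm_triangle_le) (simp add: norm_scaleC norm_power)
    finally show ?thesis .
  qed
  have "Im c = 0"
  proof (rule ccontr)
    assume nz: "Im c \<noteq> 0"
    have "(Im c)\<^sup>2 + 2 * Im c * t \<le> N" for t
      using bound[of t] by (simp add: power2_sum)
    \<comment> \<open>With this \<open>t\<close> the linear term equals \<open>N\<close> and cancels
      the bound.\<close>
    from this[of "N / (2 * Im c)"] have "(Im c)\<^sup>2 \<le> 0" using nz by simp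
    then show False using nz by simp
  qed
  then show "c \<in> \<real>" by (simp add: complex_is_Real_iff)
qed


section \<open>The spectral radius of a self-adjoint element\<close>

text \<open>Powers of \<open>a\<close> stay self-adjoint, and there the C*-identity makes the norm
  multiplicative on squares.\<close>

lemma self_adjoint_norm_power_two:
  fixes a :: "'a::unital_cstar_algebra"
  assumes "self_adjoint a" "norm a = 1"
  shows "norm (a ^ 2 ^ k) = 1"
proof (induction k)
  case (Suc k)
  have "self_adjoint (a ^ n)" for n
    using assms(1) by (induction n) (auto simp: self_adjoint_def adj_simps power_commutes)
  from self_adjoint_norm_square[OF this] Suc show ?case
    by (simp add: mult_2 power_add)
qed (simp add: assms)

section \<open>Inverses and resolvents\<close>

definition two_sided_inverse :: "'a::monoid_mult \<Rightarrow> 'a" where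
  "two_sided_inverse a = (SOME b. a * b = 1 \<and> b * a = 1)"

lemma two_sided_inverse:
  assumes "two_sided_unit a"
  shows "a * two_sided_inverse a = 1" "two_sided_inverse a * a = 1"
  using someI_ex[OF assms[unfolded two_sided_unit_def]] unfolding two_sided_inverse_def by auto

lemma two_sided_inverse_unique:
  assumes "a * b = 1" "b * a = 1"
  shows "two_sided_inverse a = b"
proof -
  have "two_sided_unit a" using assms by (rule two_sided_unitI)
  then show ?thesis using assms two_sided_inverse by (metis mult.assoc mult_1_left mult_1_right)
qed

text \<open>The resolvent identity.\<close>

lemma two_sided_inverse_diff:
  fixes a b :: "'a::ring_1"
  assumes "two_sided_unit a" "two_sided_unit b"
  shows "two_sided_inverse a - two_sided_inverse b
    = two_sided_inverse a * (b - a) * two_sided_inverse b"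
proof -
  have "two_sided_inverse a * (b - a) * two_sided_inverse b
    = two_sided_inverse a * (b * two_sided_inverse b) - (two_sided_inverse a * a) * two_sided_inverse b"
    by (simp add: algebra_simps)
  then show ?thesis using two_sided_inverse[OF assms(1)] two_sided_inverse[OF assms(2)] by simp
qed

text \<open>The partial fraction decomposition of \<open>1 / (1 - a^2)\<close>.\<close>

lemma two_sided_inverse_one_minus_square:
  fixes a :: "'a::real_algebra_1"
  assumes "two_sided_unit (1 - a)" "two_sided_unit (1 + a)"
  shows "two_sided_unit (1 - a * a)"
    "two_sided_inverse (1 - a * a)
      = (1/2) *\<^sub>R (two_sided_inverse (1 - a) + two_sided_inverse (1 + a))"
proof -
  let ?u = "two_sided_inverse (1 - a)" and ?v = "two_sided_inverse (1 + a)"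
  have f: "1 - a * a = (1 - a) * (1 + a)" "1 - a * a = (1 + a) * (1 - a)"
    by (simp_all add: algebra_simps)
  show "two_sided_unit (1 - a * a)" unfolding f(1) using assms by (rule two_sided_unit_mult)
  have "(1 - a * a) * (?u + ?v) = (1 + a) * ((1 - a) * ?u) + (1 - a) * ((1 + a) * ?v)"
    by (simp add: algebra_simps)
  also have "\<dots> = 2 *\<^sub>R 1"
    using two_sided_inverse(1)[OF assms(1)] two_sided_inverse(1)[OF assms(2)]
    by (simp add: scaleR_2)
  finally have 1: "(1 - a * a) * ((1/2) *\<^sub>R (?u + ?v)) = 1" by simp
  have "(?u + ?v) * (1 - a * a) = (?u * (1 - a)) * (1 + a) + (?v * (1 + a)) * (1 - a)"
    by (simp add: algebra_simps)
  also have "\<dots> = 2 *\<^sub>R 1"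
    using two_sided_inverse(2)[OF assms(1)] two_sided_inverse(2)[OF assms(2)]
    by (simp add: scaleR_2)
  finally have 2: "((1/2) *\<^sub>R (?u + ?v)) * (1 - a * a) = 1" by simp
  show "two_sided_inverse (1 - a * a) = (1/2) *\<^sub>R (?u + ?v)"
    by (rule two_sided_inverse_unique) fact+
qed

text \<open>The resolvent is continuous on the compact unit disc, hence bounded by some
  \<open>B\<close>. The resolvent identity then makes it Lipschitz there with constant
  \<open>B * norm a * B\<close>, so one radius \<open>s\<close> serves all \<open>w\<close>.\<close>

lemma resolvent_radially_close:
  fixes a :: "'a::complex_banach_algebra_1"
  assumes "\<And>l. cmod l \<le> 1 \<Longrightarrow> two_sided_unit (1 - l *\<^sub>C a)" and "e > 0"
  shows "\<exists>s. 0 < s \<and> s < 1 \<and> (\<forall>w. cmod w = 1 \<longrightarrow>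
    norm (two_sided_inverse (1 - w *\<^sub>C a)
      - two_sided_inverse (1 - (of_real s * w) *\<^sub>C a)) \<le> e)"
proof -
  let ?f = "\<lambda>l. two_sided_inverse (1 - l *\<^sub>C a)"
  have diff: "norm (?f l - ?f m) \<le> norm (?f l) * (cmod (l - m) * norm a) * norm (?f m)"
    if "cmod l \<le> 1" "cmod m \<le> 1" for l m
  proof -
    have "?f l - ?f m = ?f l * ((l - m) *\<^sub>C a) * ?f m"
      using two_sided_inverse_diff[OF assms(1) assms(1), OF that] by (simp add: scaleC_simps)
    also have "norm \<dots> \<le> norm (?f l) * norm ((l - m) *\<^sub>C a) * norm (?f m)"
      by (meson mult_right_mono norm_ge_zero norm_mult_ineq order_trans)
    finally show ?thesis by (simp add: norm_scaleC)
  qed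
  have "continuous_on (cball 0 1) ?f"
    unfolding continuous_on_def
  proof
    fix m :: complex assume m: "m \<in> cball 0 1"
    define K where "K = norm a * norm (?f m)"
    have K: "K \<ge> 0" unfolding K_def by simp
    have "\<forall>\<^sub>F l in at m within cball 0 1. cmod (l - m) * K < 1/2"
    proof (rule order_tendstoD(2))
      show "((\<lambda>l. cmod (l - m) * K) \<longlongrightarrow> cmod (m - m) * K) (at m within cball 0 1)"
        by (intro tendsto_intros)
    qed simp
    then have *: "\<forall>\<^sub>F l in at m within cball 0 1.
        norm (?f l - ?f m) \<le> 2 * norm (?f m) * K * cmod (l - m)"
    proof (rule eventually_mp[rotated])
      show "\<forall>\<^sub>F l in at m within cball 0 1. cmod (l - m) * K < 1/2 \<longrightarrow>
        norm (?f l - ?f m) \<le> 2 * norm (?f m) * K * cmod (l - m)"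
        unfolding eventually_at_filter
      proof (intro always_eventually allI impI)
        fix l :: complex assume l: "l \<in> cball 0 1" and small: "cmod (l - m) * K < 1/2"
        \<comment> \<open>No bound on \<open>?f\<close> is known yet: closeness of \<open>l\<close>
          to \<open>m\<close> lets half of \<open>norm (?f l)\<close> be absorbed, which yields the
          local bound \<open>2 * norm (?f m)\<close>.\<close>
        have d: "norm (?f l - ?f m) \<le> norm (?f l) * (cmod (l - m) * K)"
          using diff[of l m] l m unfolding K_def by (simp add: mult_ac)
        also have "\<dots> \<le> norm (?f l) * (1/2)" using small by (intro mult_left_mono) auto
        finally have "norm (?f l) \<le> 2 * norm (?f m)"
          using norm_triangle_ineq2[of "?f l" "?f m"] by linarith
        then have "norm (?f l) * (cmod (l - m) * K) \<le> 2 * norm (?f m) * (cmod (l - m) * K)"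
          using K by (intro mult_right_mono) auto
        with d show "norm (?f l - ?f m) \<le> 2 * norm (?f m) * K * cmod (l - m)"
          by (simp add: mult_ac)
      qed
    qed
    have "((\<lambda>l. 2 * norm (?f m) * K * cmod (l - m)) \<longlongrightarrow> 2 * norm (?f m) * K * cmod (m - m))
        (at m within cball 0 1)"
      by (intro tendsto_intros)
    then have "((\<lambda>l. ?f l - ?f m) \<longlongrightarrow> 0) (at m within cball 0 1)"
      by (intro Lim_null_comparison[OF *]) simp
    then show "(?f \<longlongrightarrow> ?f m) (at m within cball 0 1)" by (simp add: LIM_zero_iff)
  qed
  then have "bounded (?f ` cball 0 1)"
    by (intro compact_imp_bounded compact_continuous_image compact_cball)
  then obtain B where B: "B > 0" "\<And>l. cmod l \<le> 1 \<Longrightarrow> norm (?f l) \<le> B"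
    unfolding bounded_pos by auto
  \<comment> \<open>\<open>C > e\<close> keeps the radius \<open>1 - e / C\<close> positive, and
    \<open>C > B * norm a * B\<close> brings the Lipschitz estimate at distance \<open>e / C\<close>
    down to \<open>e\<close>.\<close>
  define C where "C = B * norm a * B + e + 1"
  have C: "C > e" "C > B * norm a * B" "C > 0"
    unfolding C_def using B(1) \<open>e > 0\<close> by (auto simp: add_pos_nonneg add_nonneg_pos)
  show ?thesis
  proof (intro exI[of _ "1 - e / C"] conjI allI impI)
    show "0 < 1 - e / C" "1 - e / C < 1" using C \<open>e > 0\<close> by auto
    fix w :: complex assume w: "cmod w = 1"
    let ?m = "of_real (1 - e / C) * w"
    have m: "cmod ?m \<le> 1" unfolding norm_mult norm_of_real using w C \<open>e > 0\<close> by simp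
    have wm: "cmod (w - ?m) = e / C"
    proof -
      have "w - ?m = of_real (e / C) * w" by (simp add: algebra_simps)
      then show ?thesis using w C \<open>e > 0\<close> by (simp only: norm_mult norm_of_real) simp
    qed
    have "norm (?f w - ?f ?m) \<le> norm (?f w) * (e / C * norm a) * norm (?f ?m)"
      using diff[of w ?m] w m wm by simp
    also have "\<dots> \<le> B * (e / C * norm a) * B"
      using B w m C \<open>e > 0\<close> by (intro mult_mono) auto
    also have "\<dots> = e * ((B * norm a * B) / C)" by (simp add: field_simps)
    also have "\<dots> \<le> e * 1" using C \<open>e > 0\<close> by (intro mult_left_mono) auto
    finally show "norm (?f w - ?f ?m) \<le> e" by simp
  qed
qed

text \<open>Rickart's averaging over roots of unity, for exponents \<open>2 ^ k\<close>: since
  \<open>(1 - b\<^sup>2)\<^sup>-\<^sup>1\<close> is the mean of \<open>(1 - b)\<^sup>-\<^sup>1\<close> and \<open>(1 + b)\<^sup>-\<^sup>1\<close>, the closeness of two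
  resolvents on the unit circle passes from \<open>a\<close> to \<open>a\<^sup>2\<close> with the same error.\<close>

lemma resolvent_close_power_two:
  fixes a :: "'a::complex_banach_algebra_1"
  assumes "\<And>w. cmod w = 1 \<Longrightarrow> two_sided_unit (1 - w *\<^sub>C a)"
    and "\<And>w. cmod w = 1 \<Longrightarrow> two_sided_unit (1 - (of_real s * w) *\<^sub>C a)"
    and "\<And>w. cmod w = 1 \<Longrightarrow> norm (two_sided_inverse (1 - w *\<^sub>C a)
      - two_sided_inverse (1 - (of_real s * w) *\<^sub>C a)) \<le> e"
    and "cmod w = 1"
  shows "two_sided_unit (1 - w *\<^sub>C a ^ 2 ^ k) \<and>
    two_sided_unit (1 - (of_real (s ^ 2 ^ k) * w) *\<^sub>C a ^ 2 ^ k) \<and>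
    norm (two_sided_inverse (1 - w *\<^sub>C a ^ 2 ^ k)
      - two_sided_inverse (1 - (of_real (s ^ 2 ^ k) * w) *\<^sub>C a ^ 2 ^ k)) \<le> e"
  using assms(4)
proof (induction k arbitrary: w)
  case 0
  then show ?case using assms(1-3) by simp
next
  case (Suc k)
  define b where "b = a ^ 2 ^ k"
  define t where "t = s ^ 2 ^ k"
  have b2: "a ^ 2 ^ Suc k = b * b" "s ^ 2 ^ Suc k = t * t"
    unfolding b_def t_def by (simp_all add: mult_2 power_add)
  \<comment> \<open>Both square roots of \<open>w\<close> lie on the unit circle, so the induction
    hypothesis applies to \<open>v\<close> and \<open>- v\<close>.\<close>
  define v where "v = csqrt w"
  have v: "v * v = w" unfolding v_def using power2_csqrt[of w] by (simp add: power2_eq_square)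
  have cv: "cmod v = 1" "cmod (- v) = 1"
    using Suc.prems by (simp_all add: v_def norm_csqrt)
  note IH = Suc.IH[folded b_def t_def]
  have neg: "1 - (- v) *\<^sub>C b = 1 + v *\<^sub>C b"
    "1 - (of_real t * - v) *\<^sub>C b = 1 + (of_real t * v) *\<^sub>C b"
    by (simp_all add: scaleC_simps)
  have sq: "(v *\<^sub>C b) * (v *\<^sub>C b) = w *\<^sub>C (b * b)"
    "((of_real t * v) *\<^sub>C b) * ((of_real t * v) *\<^sub>C b) = (of_real (t * t) * w) *\<^sub>C (b * b)"
    by (simp_all add: scaleC_simps flip: v) (simp add: mult_ac)
  let ?I = "two_sided_inverse"
  let ?A = "v *\<^sub>C b" and ?B = "(of_real t * v) *\<^sub>C b"
  have u: "two_sided_unit (1 - ?A)" "two_sided_unit (1 + ?A)"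
    "two_sided_unit (1 - ?B)" "two_sided_unit (1 + ?B)"
    and n: "norm (?I (1 - ?A) - ?I (1 - ?B)) \<le> e" "norm (?I (1 + ?A) - ?I (1 + ?B)) \<le> e"
    using IH[OF cv(1)] IH[OF cv(2)] unfolding neg by auto
  note A = two_sided_inverse_one_minus_square[OF u(1,2), unfolded sq]
  note B = two_sided_inverse_one_minus_square[OF u(3,4), unfolded sq]
  have "?I (1 - w *\<^sub>C (b * b)) - ?I (1 - (of_real (t * t) * w) *\<^sub>C (b * b))
    = (1/2) *\<^sub>R ((?I (1 - ?A) - ?I (1 - ?B)) + (?I (1 + ?A) - ?I (1 + ?B)))"
    unfolding A B by (simp add: algebra_simps)
  also have "norm \<dots> \<le> e"
    using norm_triangle_ineq[of "?I (1 - ?A) - ?I (1 - ?B)" "?I (1 + ?A) - ?I (1 + ?B)"] n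
    by simp
  finally show ?case unfolding b2 using A B by blast
qed

lemma two_sided_inverse_one_minus_close:
  fixes a :: "'a::{real_normed_algebra_1,banach}"
  assumes "norm a \<le> 1/9"
  shows "norm (two_sided_inverse (1 - a) - 1) \<le> 1/8"
proof -
  let ?u = "two_sided_inverse (1 - a)"
  have "two_sided_unit (1 - a)" using assms by (intro two_sided_unit_one_minus) simp
  then have "(1 - a) * ?u = 1" by (rule two_sided_inverse)
  then have eq: "?u - 1 = a * (?u - 1) + a" by (simp add: algebra_simps)
  have "norm (?u - 1) \<le> norm (a * (?u - 1)) + norm a"
    using norm_triangle_ineq[of "a * (?u - 1)" a] by (simp flip: eq)
  also have "norm (a * (?u - 1)) \<le> 1/9 * norm (?u - 1)"
    using norm_mult_ineq[of a "?u - 1"] assms mult_right_mono[OF assms norm_ge_zero[of "?u - 1"]]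
    by linarith
  finally show ?thesis using assms by linarith
qed

text \<open>With \<open>u\<close> the inverse, \<open>a = (u - 1) - a (u - 1)\<close> gives
  \<open>norm a \<le> 1/4 + norm a / 4\<close>.\<close>

lemma norm_lt_one_if_two_sided_inverse_close:
  fixes a :: "'a::{real_normed_algebra_1,banach}"
  assumes "two_sided_unit (1 - a)" "norm (two_sided_inverse (1 - a) - 1) \<le> 1/4"
  shows "norm a < 1"
proof -
  let ?u = "two_sided_inverse (1 - a)"
  have "(1 - a) * ?u = 1" using assms(1) by (rule two_sided_inverse)
  then have eq: "a = (?u - 1) - a * (?u - 1)" by (simp add: algebra_simps)
  have "norm a \<le> norm (?u - 1) + norm (a * (?u - 1))"
    using norm_triangle_ineq4[of "?u - 1" "a * (?u - 1)"] by (simp flip: eq)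
  also have "norm (a * (?u - 1)) \<le> norm a * (1/4)"
    using norm_mult_ineq[of a "?u - 1"] mult_left_mono[OF assms(2) norm_ge_zero[of a]] by linarith
  finally show ?thesis using assms(2) by linarith
qed

text \<open>The hard half of the spectral radius formula, without complex analysis. Were the norm
  larger than \<open>r\<close>, the normalised \<open>b\<close> would have resolvents on the whole
  closed unit disc. Averaging keeps those of \<open>b ^ 2 ^ k\<close> at radii \<open>1\<close> and
  \<open>s ^ 2 ^ k\<close> close for all \<open>k\<close>, while the inner one approaches
  \<open>1\<close>. The outer one is then near \<open>1\<close>, which forces
  \<open>norm (b ^ 2 ^ k) < 1\<close>, against the C*-identity.\<close>

lemma self_adjoint_norm_le_spectrum:
  fixes a :: "'a::unital_cstar_algebra"
  assumes "self_adjoint a" "alg_spectrum a \<subseteq> cball 0 r" "r \<ge> 0"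
  shows "norm a \<le> r"
proof (rule ccontr)
  assume "\<not> norm a \<le> r"
  then have N: "norm a > r" "norm a > 0" using assms(3) by auto
  define b where "b = (1 / norm a) *\<^sub>R a"
  have b: "self_adjoint b" "norm b = 1"
    using assms(1) N unfolding b_def by (auto simp: self_adjoint_def adj_simps)
  have unit: "two_sided_unit (1 - l *\<^sub>C b)" if l: "cmod l \<le> 1" for l
  proof (cases "l = 0")
    case False
    let ?c = "complex_of_real (norm a) / l"
    have "cmod ?c \<ge> norm a" using l False N by (simp add: norm_divide field_simps)
    then have "?c \<notin> alg_spectrum a" using assms(2) N by auto
    moreover have "inverse ?c *\<^sub>C a = l *\<^sub>C b"
      unfolding b_def using N by (simp add: scaleR_scaleC scaleC_simps divide_simps)
    ultimately show ?thesis using alg_spectrum_iff_one_minus[of ?c a] N False by auto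
  qed (simp add: scaleC_zero_left two_sided_unit_one)
  \<comment> \<open>The errors add up: \<open>1/8\<close> between the two radii and
    \<open>1/8\<close> from the inner resolvent to \<open>1\<close> give the \<open>1/4\<close> that
    excludes norm \<open>1\<close>.\<close>
  obtain s where s: "0 < s" "s < 1" and close: "\<And>w. cmod w = 1 \<Longrightarrow>
      norm (two_sided_inverse (1 - w *\<^sub>C b)
        - two_sided_inverse (1 - (of_real s * w) *\<^sub>C b)) \<le> 1/8"
    using resolvent_radially_close[OF unit, of "1/8"] by auto
  have "(\<lambda>n. s ^ n) \<longlonglongrightarrow> 0" using s by (intro LIMSEQ_power_zero) auto
  then have "\<forall>\<^sub>F n in sequentially. s ^ n < 1/9" by (rule order_tendstoD) simp
  then obtain k where k: "s ^ 2 ^ k < 1/9"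
    unfolding eventually_sequentially by (metis less_exp less_imp_le)
  let ?b = "b ^ 2 ^ k"
  have nb: "norm ?b = 1" using b by (rule self_adjoint_norm_power_two)
  have "two_sided_unit (1 - 1 *\<^sub>C ?b) \<and>
    two_sided_unit (1 - (of_real (s ^ 2 ^ k) * 1) *\<^sub>C ?b) \<and>
    norm (two_sided_inverse (1 - 1 *\<^sub>C ?b)
      - two_sided_inverse (1 - (of_real (s ^ 2 ^ k) * 1) *\<^sub>C ?b)) \<le> 1/8"
    using s by (intro resolvent_close_power_two close unit) (auto simp: norm_mult)
  then have u: "two_sided_unit (1 - ?b)"
    and d: "norm (two_sided_inverse (1 - ?b)
      - two_sided_inverse (1 - of_real (s ^ 2 ^ k) *\<^sub>C ?b)) \<le> 1/8"
    by (simp_all add: scaleC_one)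
  have "norm (complex_of_real (s ^ 2 ^ k) *\<^sub>C ?b) \<le> 1/9"
    using nb k s unfolding norm_scaleC norm_of_real by simp
  from two_sided_inverse_one_minus_close[OF this] d
  have "norm (two_sided_inverse (1 - ?b) - 1) \<le> 1/4"
    using norm_triangle_ineq[of "two_sided_inverse (1 - ?b)
        - two_sided_inverse (1 - of_real (s ^ 2 ^ k) *\<^sub>C ?b)"
      "two_sided_inverse (1 - of_real (s ^ 2 ^ k) *\<^sub>C ?b) - 1"] by simp
  from norm_lt_one_if_two_sided_inverse_close[OF u this] nb show False by simp
qed

lemma self_adjoint_eq_zero_if_spectrum:
  fixes a :: "'a::unital_cstar_algebra"
  assumes "self_adjoint a" "alg_spectrum a \<subseteq> {0}"
  shows "a = 0"
  using self_adjoint_norm_le_spectrum[of a 0] assms by auto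


section \<open>Positive elements and square roots\<close>

text \<open>Spectra of self-adjoint elements are real, so only the sign of the real part has to be
  checked.\<close>

lemma positive_elem_iff:
  "positive_elem a \<longleftrightarrow> self_adjoint a \<and> (\<forall>c \<in> alg_spectrum a. 0 \<le> Re c)"
proof
  assume "self_adjoint a \<and> (\<forall>c \<in> alg_spectrum a. 0 \<le> Re c)"
  moreover from this have "alg_spectrum a \<subseteq> \<real>" using self_adjoint_alg_spectrum_real by blast
  ultimately show "positive_elem a"
    unfolding positive_elem_def
    by (auto simp: image_iff subset_iff Bex_def complex_is_Real_iff complex_eq_iff)
qed (auto simp: positive_elem_def)

lemma positive_elem_spectrum:
  assumes "positive_elem a" "c \<in> alg_spectrum a"
  obtains t where "t \<ge> 0" "c = of_real t"
  using assms unfolding positive_elem_def by auto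

lemma positive_elem_square: "self_adjoint a \<Longrightarrow> positive_elem (a * a)"
  using alg_spectrum_square_nonneg[OF self_adjoint_alg_spectrum_real]
  by (auto simp: positive_elem_def self_adjoint_def adj_simps)

lemma positive_elem_zero: "positive_elem 0"
  by (auto simp: positive_elem_iff self_adjoint_def adj_zero dest!: alg_spectrum_norm_le)

lemma positive_elem_scaleR:
  assumes "positive_elem a" "r > 0"
  shows "positive_elem (r *\<^sub>R a)"
  using assms by (auto simp: positive_elem_iff self_adjoint_def adj_simps)
    (auto simp: scaleR_scaleC alg_spectrum_scaleC zero_le_divide_iff dest!: bspec)

lemma positive_elem_add_orthogonal:
  assumes "positive_elem a" "positive_elem b" "a * b = 0" "b * a = 0"
  shows "positive_elem (a + b)"
  unfolding positive_elem_iff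
proof (intro conjI ballI)
  show "self_adjoint (a + b)"
    using assms by (simp add: positive_elem_def self_adjoint_def adj_simps)
  fix c assume "c \<in> alg_spectrum (a + b)"
  then show "0 \<le> Re c"
    using alg_spectrum_add_orthogonal[OF assms(3,4), of c] assms(1,2)
    by (cases "c = 0") (auto simp: positive_elem_iff)
qed

text \<open>The spectrum lies in the closed disc of radius \<open>1\<close> about \<open>1\<close>,
  hence in the right half-plane.\<close>

lemma positive_elem_if_norm_one_minus_le:
  assumes "self_adjoint a" "norm (1 - a) \<le> 1"
  shows "positive_elem a"
  unfolding positive_elem_iff
proof (intro conjI ballI assms)
  fix c assume "c \<in> alg_spectrum a"
  then have "c - 1 \<in> alg_spectrum (a - 1)"
    using alg_spectrum_shift[of "c - 1" a "- 1"] by (simp add: scaleC_simps scaleC_one)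
  from alg_spectrum_norm_le[OF this] assms have "cmod (c - 1) \<le> 1"
    by (simp add: norm_minus_commute)
  then show "0 \<le> Re c" using abs_Re_le_cmod[of "c - 1"] by simp
qed

text \<open>The spectrum of \<open>a\<close>, hence that of \<open>1 - a\<close>, lies in
  \<open>[0, 1]\<close>, and the spectrum controls the norm of a self-adjoint element.\<close>

lemma norm_one_minus_positive_elem_le:
  assumes "positive_elem a" "norm a \<le> 1"
  shows "norm (1 - a) \<le> 1"
proof (rule self_adjoint_norm_le_spectrum)
  show "self_adjoint (1 - a)"
    using assms by (simp add: positive_elem_def self_adjoint_def adj_simps)
  show "alg_spectrum (1 - a) \<subseteq> cball 0 1"
  proof
    fix c assume "c \<in> alg_spectrum (1 - a)"
    then have c: "1 - c \<in> alg_spectrum a"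
      using alg_spectrum_shift[of c "- a" 1] alg_spectrum_minus[of "c - 1" a]
      by (simp add: scaleC_one)
    then obtain t where t: "t \<ge> 0" "1 - c = of_real t"
      using assms(1) positive_elem_spectrum by blast
    then have "t \<le> 1" using alg_spectrum_norm_le[OF c] assms(2) by simp
    moreover have "c = of_real (1 - t)" using t by (simp add: algebra_simps)
    ultimately show "c \<in> cball 0 1" using t(1) by (simp del: of_real_diff)
  qed
qed simp

text \<open>The iterates converge to the solution \<open>y\<close> of \<open>2y = b + y\<^sup>2\<close>, that is
  \<open>(1 - y)\<^sup>2 = 1 - b\<close>; for \<open>\<parallel>b\<parallel> \<le> 1\<close> their increments are dominated by those
  of the scalar iteration with \<open>b = 1\<close>.\<close>

primrec sqrt_iter :: "'a::real_algebra_1 \<Rightarrow> nat \<Rightarrow> 'a" where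
  "sqrt_iter b 0 = 0"
| "sqrt_iter b (Suc n) = (1/2) *\<^sub>R (b + sqrt_iter b n * sqrt_iter b n)"

lemma sqrt_iter_commute:
  assumes "z * b = b * z"
  shows "z * sqrt_iter b n = sqrt_iter b n * z"
proof (induction n)
  case (Suc n)
  have "z * (sqrt_iter b n * sqrt_iter b n) = sqrt_iter b n * sqrt_iter b n * z"
    by (metis Suc mult.assoc)
  then show ?case using assms by (simp add: algebra_simps)
qed simp

lemma sqrt_iter_one_bounds: "0 \<le> sqrt_iter (1::real) n \<and> sqrt_iter (1::real) n \<le> 1"
proof (induction n)
  case (Suc n)
  then have "sqrt_iter (1::real) n * sqrt_iter 1 n \<le> 1 * 1" by (intro mult_mono) auto
  then show ?case using Suc by simp
qed simp

text \<open>Each new increment is half the product of the previous increment and the sum of the two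
  iterates. The norm bound controls that sum and itself follows from the increment bound, so both go
  through one induction.\<close>

lemma sqrt_iter_dominated:
  fixes b :: "'a::real_normed_algebra_1"
  assumes "norm b \<le> 1"
  shows "norm (sqrt_iter b n) \<le> sqrt_iter (1::real) n \<and>
    norm (sqrt_iter b (Suc n) - sqrt_iter b n) \<le> sqrt_iter (1::real) (Suc n) - sqrt_iter 1 n"
proof (induction n)
  case (Suc n)
  define y where "y = sqrt_iter b"
  define t where "t = sqrt_iter (1::real)"
  note IH = Suc[folded y_def t_def]
  have y: "y (Suc m) = (1/2) *\<^sub>R (b + y m * y m)" and t: "t (Suc m) = (1 + t m * t m) / 2" for m
    by (simp_all add: y_def t_def)
  have 1: "norm (y (Suc n)) \<le> t (Suc n)"
    using IH norm_triangle_ineq[of "y (Suc n) - y n" "y n"] by simp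
  \<comment> \<open>Each iterate commutes with \<open>b\<close>, hence with every other
    iterate.\<close>
  have comm: "y (Suc n) * y n = y n * y (Suc n)"
    unfolding y_def by (rule sqrt_iter_commute[OF sqrt_iter_commute[OF refl, symmetric]])
  have "y (Suc (Suc n)) - y (Suc n) = (1/2) *\<^sub>R (y (Suc n) * y (Suc n) - y n * y n)"
    using y[of "Suc n"] y[of n] by (metis add_diff_cancel_left scaleR_diff_right)
  also have "y (Suc n) * y (Suc n) - y n * y n = (y (Suc n) - y n) * (y (Suc n) + y n)"
    using comm by (simp add: algebra_simps)
  finally have "norm (y (Suc (Suc n)) - y (Suc n))
      \<le> (1/2) * (norm (y (Suc n) - y n) * norm (y (Suc n) + y n))"
    using norm_mult_ineq[of "y (Suc n) - y n" "y (Suc n) + y n"] by simp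
  also have "norm (y (Suc n) - y n) * norm (y (Suc n) + y n)
      \<le> (t (Suc n) - t n) * (t (Suc n) + t n)"
    using IH 1 norm_triangle_ineq[of "y (Suc n)" "y n"] norm_ge_zero[of "y (Suc n) - y n"]
    by (intro mult_mono) (linarith | rule norm_ge_zero)+
  also have "(1/2) * ((t (Suc n) - t n) * (t (Suc n) + t n)) = t (Suc (Suc n)) - t (Suc n)"
    unfolding t[of "Suc n"] t[of n] by (simp add: field_simps)
  finally show ?case using 1 unfolding y_def t_def by simp
qed (use assms in simp)

text \<open>The scalar iterates increase and stay below \<open>1\<close>, so their increments, and
  with them the dominated ones, are summable.\<close>

lemma sqrt_iter_convergent:
  fixes b :: "'a::{real_normed_algebra_1,banach}"
  assumes "norm b \<le> 1"
  shows "convergent (sqrt_iter b)"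
proof -
  let ?t = "sqrt_iter (1::real)"
  have "incseq ?t"
  proof (rule incseq_SucI)
    show "?t n \<le> ?t (Suc n)" for n
      using sqrt_iter_dominated[of "1::real" n] norm_ge_zero order_trans by fastforce
  qed
  then have "convergent ?t"
    using incseq_convergent[of ?t 1] sqrt_iter_one_bounds unfolding convergent_def by blast
  then have "summable (\<lambda>n. ?t (Suc n) - ?t n)"
    using telescope_summable unfolding convergent_def by blast
  then have "summable (\<lambda>n. sqrt_iter b (Suc n) - sqrt_iter b n)"
    by (rule summable_comparison_test'[where N = 0])
      (rule conjunct2[OF sqrt_iter_dominated[OF assms]])
  then have "convergent (\<lambda>n. \<Sum>k<n. sqrt_iter b (Suc k) - sqrt_iter b k)"
    by (simp only: summable_iff_convergent)
  then show ?thesis unfolding sum_lessThan_telescope by simp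
qed

text \<open>The root is \<open>1 - y\<close>, with \<open>y\<close> the limit of the iteration for
  \<open>b = 1 - a\<close>; it is positive because \<open>norm y \<le> 1\<close>. The commutation
  clause stands in for functional calculus, both for uniqueness of roots and for orthogonality of
  the two parts.\<close>

lemma positive_sqrt_unit_ball:
  fixes a :: "'a::unital_cstar_algebra"
  assumes "positive_elem a" "norm a \<le> 1"
  shows "\<exists>s. positive_elem s \<and> s * s = a \<and> (\<forall>z. z * a = a * z \<longrightarrow> z * s = s * z)"
proof -
  define b where "b = 1 - a"
  have b: "norm b \<le> 1" unfolding b_def using assms by (rule norm_one_minus_positive_elem_le)
  have sa: "adj b = b"
    unfolding b_def using assms by (simp add: positive_elem_def self_adjoint_def adj_simps)
  obtain y where y: "sqrt_iter b \<longlonglongrightarrow> y"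
    using sqrt_iter_convergent[OF b] unfolding convergent_def by blast
  have "(\<lambda>n. sqrt_iter b (Suc n)) \<longlonglongrightarrow> (1/2) *\<^sub>R (b + y * y)"
    unfolding sqrt_iter.simps by (intro tendsto_intros y)
  with LIMSEQ_Suc[OF y] have fix_y: "y = (1/2) *\<^sub>R (b + y * y)" by (rule LIMSEQ_unique)
  have "norm y \<le> 1"
  proof (rule LIMSEQ_le_const2[OF tendsto_norm[OF y]])
    show "\<exists>N. \<forall>n\<ge>N. norm (sqrt_iter b n) \<le> 1"
      using sqrt_iter_dominated[OF b] sqrt_iter_one_bounds order_trans by blast
  qed
  moreover have "adj (sqrt_iter b n) = sqrt_iter b n" for n
    by (induction n) (simp_all add: adj_simps sa)
  then have "adj y = y" using LIMSEQ_unique[OF tendsto_adj[OF y]] y by simp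
  ultimately have "positive_elem (1 - y)"
    by (intro positive_elem_if_norm_one_minus_le) (simp_all add: self_adjoint_def adj_simps)
  moreover have "(1 - y) * (1 - y) = a"
  proof -
    have "2 *\<^sub>R y = b + y * y" by (subst fix_y) simp
    then show ?thesis unfolding b_def by (simp add: algebra_simps scaleR_2)
  qed
  moreover have "z * (1 - y) = (1 - y) * z" if "z * a = a * z" for z
  proof -
    have "z * b = b * z" using that unfolding b_def by (simp add: algebra_simps)
    then have eq: "(\<lambda>n. z * sqrt_iter b n) = (\<lambda>n. sqrt_iter b n * z)"
      using sqrt_iter_commute by blast
    have "(\<lambda>n. z * sqrt_iter b n) \<longlonglongrightarrow> z * y" "(\<lambda>n. sqrt_iter b n * z) \<longlonglongrightarrow> y * z"
      by (intro tendsto_intros y)+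
    then have "z * y = y * z" unfolding eq by (rule LIMSEQ_unique)
    then show ?thesis by (simp add: algebra_simps)
  qed
  ultimately show ?thesis by blast
qed

lemma positive_sqrt:
  fixes a :: "'a::unital_cstar_algebra"
  assumes "positive_elem a"
  obtains s where "positive_elem s" "s * s = a" "\<And>z. z * a = a * z \<Longrightarrow> z * s = s * z"
proof (cases "a = 0")
  case True
  then show ?thesis using that[of 0] positive_elem_zero by simp
next
  case False
  then have N: "norm a > 0" by simp
  let ?a = "(1 / norm a) *\<^sub>R a"
  have "positive_elem ?a" using assms N by (intro positive_elem_scaleR) auto
  moreover have "norm ?a \<le> 1" using N by simp
  ultimately obtain s where s: "positive_elem s" "s * s = ?a" "\<And>z. z * ?a = ?a * z \<Longrightarrow> z * s = s * z"
    using positive_sqrt_unit_ball[of ?a] \<open>norm ?a \<le> 1\<close> by blast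
  show ?thesis
  proof (rule that[of "sqrt (norm a) *\<^sub>R s"])
    show "positive_elem (sqrt (norm a) *\<^sub>R s)" using s(1) N by (intro positive_elem_scaleR) auto
    show "sqrt (norm a) *\<^sub>R s * sqrt (norm a) *\<^sub>R s = a" using s(2) N by simp
    show "z * sqrt (norm a) *\<^sub>R s = sqrt (norm a) *\<^sub>R s * z" if "z * a = a * z" for z
      using s(3)[of z] that by simp
  qed
qed

text \<open>The spectrum of \<open>a * a = - (b * b)\<close> is both nonnegative and
  nonpositive.\<close>

lemma sum_squares_eq_zero:
  assumes "self_adjoint a" "self_adjoint b" "a * a + b * b = 0"
  shows "a = 0"
proof -
  have eq: "a * a = - (b * b)" using assms(3) by (simp add: eq_neg_iff_add_eq_0)
  have "alg_spectrum (a * a) \<subseteq> {0}"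
  proof
    fix c assume c: "c \<in> alg_spectrum (a * a)"
    obtain t where t: "t \<ge> 0" "c = of_real t"
      using positive_elem_spectrum[OF positive_elem_square[OF assms(1)] c] by blast
    have "- c \<in> alg_spectrum (b * b)" using c unfolding eq by (simp add: alg_spectrum_minus)
    then obtain u where u: "u \<ge> 0" "- c = of_real u"
      using positive_elem_spectrum[OF positive_elem_square[OF assms(2)]] by blast
    have "complex_of_real (t + u) = 0" using t u by (simp flip: t(2) u(2))
    then have "t + u = 0" by (simp only: of_real_eq_0_iff)
    then show "c \<in> {0}" using t u by simp
  qed
  then have "a * a = 0"
    using assms(1) positive_elem_square by (intro self_adjoint_eq_zero_if_spectrum) (auto simp: positive_elem_def)
  then show ?thesis using adj_mult_self_eq_zero[of a] assms(1) by (simp add: self_adjoint_def)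
qed

text \<open>With \<open>d = a - b\<close> and square roots \<open>s\<close>, \<open>t\<close> of \<open>a\<close>, \<open>b\<close>, commutation gives
  \<open>(d s)\<^sup>2 + (d t)\<^sup>2 = d\<^sup>2 (a + b) = d (a\<^sup>2 - b\<^sup>2) = 0\<close>, so \<open>d a = d b = 0\<close> and \<open>d\<^sup>2 = 0\<close>.\<close>

lemma positive_sqrt_unique:
  fixes a b :: "'a::unital_cstar_algebra"
  assumes "positive_elem a" "positive_elem b" "a * b = b * a" "a * a = b * b"
  shows "a = b"
proof -
  define d where "d = a - b"
  have sa: "adj a = a" "adj b = b" "adj d = d"
    using assms(1,2) unfolding d_def by (auto simp: positive_elem_def self_adjoint_def adj_simps)
  obtain s where s: "positive_elem s" "s * s = a" "\<And>z. z * a = a * z \<Longrightarrow> z * s = s * z"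
    using positive_sqrt[OF assms(1)] by blast
  obtain t where t: "positive_elem t" "t * t = b" "\<And>z. z * b = b * z \<Longrightarrow> z * t = t * z"
    using positive_sqrt[OF assms(2)] by blast
  have da: "d * a = a * d" and db: "d * b = b * d"
    unfolding d_def using assms(3) by (simp_all add: algebra_simps)
  note ds = s(3)[OF da] and dt = t(3)[OF db]
  have sat: "adj s = s" "adj t = t" using s(1) t(1) by (auto simp: positive_elem_def self_adjoint_def)
  have sq: "(d * s) * (d * s) = d * d * a" "(d * t) * (d * t) = d * d * b"
    unfolding s(2)[symmetric] t(2)[symmetric] by (metis ds dt mult.assoc)+
  have "d * (a + b) = 0" unfolding d_def using assms(3,4) by (simp add: algebra_simps)
  then have sum: "d * d * a + d * d * b = 0" by (metis distrib_left mult.assoc mult_zero_right)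
  have "self_adjoint (d * s)" "self_adjoint (d * t)"
    by (simp_all add: self_adjoint_def adj_mult sat sa ds dt)
  moreover have "(d * s) * (d * s) + (d * t) * (d * t) = 0" unfolding sq by (rule sum)
  moreover from this have "(d * t) * (d * t) + (d * s) * (d * s) = 0" by (simp only: add.commute)
  ultimately have "d * s = 0" "d * t = 0" using sum_squares_eq_zero by blast+
  then have "d * a = 0" "d * b = 0"
    unfolding s(2)[symmetric] t(2)[symmetric] mult.assoc[symmetric] by simp_all
  then have "d * d = 0" by (simp add: d_def right_diff_distrib)
  then have "d = 0" using adj_mult_self_eq_zero[of d] sa by simp
  then show ?thesis by (simp add: d_def)
qed

section \<open>Positive and negative parts\<close>

text \<open>Here \<open>s\<close> is the absolute value of \<open>x\<close>. The two parts are
  orthogonal with sum \<open>s\<close>, so their nonzero spectral values are among those of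
  \<open>s\<close>.\<close>

lemma pos_neg_decomp_exists:
  fixes x :: "'a::unital_cstar_algebra"
  assumes "self_adjoint x"
  obtains s where "positive_elem s" "s * s = x * x" "\<And>z. z * (x * x) = (x * x) * z \<Longrightarrow> z * s = s * z"
    "pos_neg_decomp x ((1/2) *\<^sub>R (s + x)) ((1/2) *\<^sub>R (s - x))"
proof -
  obtain s where s: "positive_elem s" "s * s = x * x"
      "\<And>z. z * (x * x) = (x * x) * z \<Longrightarrow> z * s = s * z"
    using positive_sqrt[OF positive_elem_square[OF assms]] by blast
  define p q where "p = (1/2) *\<^sub>R (s + x)" and "q = (1/2) *\<^sub>R (s - x)"
  have sx: "x * s = s * x" using s(3)[of x] by (simp add: mult.assoc)
  have pq: "p * q = 0" "q * p = 0" unfolding p_def q_def using s(2) sx by (simp_all add: algebra_simps)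
  have sum: "s = p + q" unfolding p_def q_def by (simp flip: scaleR_add_right scaleR_2)
  have sa: "self_adjoint p" "self_adjoint q"
    using s(1) assms unfolding p_def q_def
    by (simp_all add: positive_elem_def self_adjoint_def adj_simps)
  have "0 \<le> Re c" if "c \<in> alg_spectrum p \<or> c \<in> alg_spectrum q" for c
    using alg_spectrum_add_orthogonal[OF pq, of c] that s(1) unfolding sum positive_elem_iff
    by (cases "c = 0") auto
  then have "positive_elem p" "positive_elem q" using sa by (auto simp: positive_elem_iff)
  moreover have "x = p - q" unfolding p_def q_def by (simp flip: scaleR_diff_right scaleR_2)
  ultimately have "pos_neg_decomp x p q" using pq unfolding pos_neg_decomp_def by blast
  then show ?thesis using that s unfolding p_def q_def by blast
qed

text \<open>\<open>p + q\<close> is positive with square \<open>x * x\<close>, so uniqueness of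
  positive roots identifies it with \<open>s\<close>.\<close>

lemma pos_neg_decomp_unique:
  assumes "pos_neg_decomp x p q" "positive_elem s" "s * s = x * x"
    "\<And>z. z * (x * x) = (x * x) * z \<Longrightarrow> z * s = s * z"
  shows "p = (1/2) *\<^sub>R (s + x)" "q = (1/2) *\<^sub>R (s - x)"
proof -
  have d: "positive_elem p" "positive_elem q" "x = p - q" "p * q = 0" "q * p = 0"
    using assms(1) unfolding pos_neg_decomp_def by auto
  have sq: "(p + q) * (p + q) = x * x" unfolding d(3) using d(4,5) by (simp add: algebra_simps)
  \<comment> \<open>\<open>p + q\<close> commutes with its own square, which is
    \<open>x * x\<close>.\<close>
  have comm: "(p + q) * s = s * (p + q)"
    by (rule assms(4)) (simp only: mult.assoc flip: sq)
  have s: "p + q = s"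
    using positive_sqrt_unique[OF positive_elem_add_orthogonal[OF d(1,2,4,5)] assms(2) comm]
    by (simp add: sq assms(3))
  have "s + x = 2 *\<^sub>R p" "s - x = 2 *\<^sub>R q"
    unfolding s[symmetric] d(3) by (simp_all add: scaleR_2)
  then show "p = (1/2) *\<^sub>R (s + x)" "q = (1/2) *\<^sub>R (s - x)" by simp_all
qed

text \<open>Existence and uniqueness give the definite descriptions their meaning; the equivalence
  can then be proved for any decomposition.\<close>

lemma pos_neg_decomp_parts:
  assumes "self_adjoint x"
  shows "pos_neg_decomp x (pos_part x) (neg_part x)"
proof -
  obtain s where s: "positive_elem s" "s * s = x * x"
    "\<And>z. z * (x * x) = (x * x) * z \<Longrightarrow> z * s = s * z"
    "pos_neg_decomp x ((1/2) *\<^sub>R (s + x)) ((1/2) *\<^sub>R (s - x))"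
    using pos_neg_decomp_exists[OF assms] by blast
  note u = pos_neg_decomp_unique[OF _ s(1-3)]
  have "pos_part x = (1/2) *\<^sub>R (s + x)"
    unfolding pos_part_def using s(4) u by (intro the_equality) blast+
  moreover have "neg_part x = (1/2) *\<^sub>R (s - x)"
    unfolding neg_part_def using s(4) u by (intro the_equality) blast+
  ultimately show ?thesis using s(4) by simp
qed

section \<open>The equivalence\<close>

lemma alg_spectrum_positive_mult_self_adjoint_real:
  assumes "positive_elem p" "self_adjoint y"
  shows "alg_spectrum (p * y) \<subseteq> \<real>"
proof
  fix c assume c: "c \<in> alg_spectrum (p * y)"
  obtain r where r: "positive_elem r" "r * r = p" using positive_sqrt[OF assms(1)] by blast
  show "c \<in> \<real>"
  proof (cases "c = 0")
    case False
    then have "c \<in> alg_spectrum (r * y * r)"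
      using c alg_spectrum_mult_commute[of c r "r * y"] by (simp add: mult.assoc flip: r(2))
    moreover have "self_adjoint (r * y * r)"
      using assms(2) r(1) by (simp add: positive_elem_def self_adjoint_def adj_mult mult.assoc)
    ultimately show ?thesis using self_adjoint_alg_spectrum_real by blast
  qed simp
qed

lemma alg_spectrum_mult_real:
  assumes "pos_neg_decomp x p q" "\<And>z. p * z * q = 0" "self_adjoint y"
  shows "alg_spectrum (x * y) \<subseteq> \<real>"
proof
  fix c assume c: "c \<in> alg_spectrum (x * y)"
  have d: "positive_elem p" "positive_elem q" "x = p - q"
    using assms(1) unfolding pos_neg_decomp_def by auto
  then have sa: "adj p = p" "adj q = q" by (auto simp: positive_elem_def self_adjoint_def)
  \<comment> \<open>Taking adjoints exchanges \<open>p\<close> and \<open>q\<close> in the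
    hypothesis.\<close>
  have "q * z * p = 0" for z
    using arg_cong[OF assms(2)[of "adj z"], of adj] by (simp add: adj_simps sa mult.assoc)
  then have orth: "(p * y) * - (q * y) = 0" "- (q * y) * (p * y) = 0"
    using assms(2) by (simp_all flip: mult.assoc)
  have eq: "x * y = p * y + - (q * y)" unfolding d(3) by (simp add: algebra_simps)
  show "c \<in> \<real>"
  proof (cases "c = 0")
    case False
    then have "c \<in> alg_spectrum (p * y) \<or> - c \<in> alg_spectrum (q * y)"
      using c alg_spectrum_add_orthogonal[OF orth] unfolding eq by (simp add: alg_spectrum_minus)
    then show ?thesis
      using alg_spectrum_positive_mult_self_adjoint_real d(1,2) assms(3)
      by (metis Reals_minus_iff subsetD)
  qed simp
qed

lemma pos_mult_neg_eq_zero: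
  assumes "pos_neg_decomp x p q"
    and "\<And>y. self_adjoint y \<Longrightarrow> alg_spectrum (x * y) \<subseteq> \<real>"
  shows "p * z * q = 0"
proof -
  have d: "positive_elem p" "positive_elem q" "x = p - q" "p * q = 0" "q * p = 0"
    using assms(1) unfolding pos_neg_decomp_def by auto
  obtain r where r: "positive_elem r" "r * r = p" using positive_sqrt[OF d(1)] by blast
  obtain s where s: "positive_elem s" "s * s = q" using positive_sqrt[OF d(2)] by blast
  have sa: "adj r = r" "adj s = s" "adj p = p" "adj q = q"
    using r(1) s(1) d(1,2) by (auto simp: positive_elem_def self_adjoint_def)
  have sa': "self_adjoint r" "self_adjoint s" using sa by (simp_all add: self_adjoint_def)
  \<comment> \<open>Orthogonality of \<open>p\<close> and \<open>q\<close> passes to their square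
    roots.\<close>
  have rq: "r * q = 0" using self_adjoint_square_mult_eq_zero[OF sa'(1), of q] r d(4) by simp
  have sp: "s * p = 0" using self_adjoint_square_mult_eq_zero[OF sa'(2), of p] s d(5) by simp
  have qr: "q * r = 0" using arg_cong[OF rq, of adj] by (simp add: adj_simps sa)
  have ps: "p * s = 0" using arg_cong[OF sp, of adj] by (simp add: adj_simps sa)
  have sr: "s * r = 0" using self_adjoint_square_mult_eq_zero[OF sa'(2), of r] s qr by simp
  have rs: "r * s = 0" using arg_cong[OF sr, of adj] by (simp add: adj_simps sa)
  \<comment> \<open>The trailing factor lets these relations rewrite inside right-associated
    products.\<close>
  have zero: "q * (p * u) = 0" "s * (r * u) = 0" "r * (s * u) = 0" "p * (s * u) = 0"
    "q * (r * u) = 0" "r * (q * u) = 0" "p * (q * u) = 0"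
    "s * (p * u) = 0" for u
    using d(4,5) sr rs ps qr rq sp by (simp_all flip: mult.assoc)

  define v where "v = p * z * q"
  define w where "w = r * z * s"
  define y where "y = w + adj w"
  define U where "U = p * (w * q * adj w)"
  define U' where "U' = q * (adj w * p * w)"
  have y: "self_adjoint y" unfolding y_def self_adjoint_def by (simp add: adj_simps add.commute)
  \<comment> \<open>Since \<open>p * adj w = 0\<close> and \<open>q * w = 0\<close>,
    \<open>x * y\<close> is \<open>p * w - q * adj w\<close>. On squaring, \<open>w * p = 0\<close>
    and \<open>adj w * q = 0\<close> leave only the two mixed terms, both negative in sign.\<close>
  have sqs: "(x * y) * (x * y) = - (U + U')"
    unfolding d(3) y_def w_def U_def U'_def
    by (simp add: adj_simps sa algebra_simps zero)
  have orthU: "U * U' = 0" "U' * U = 0"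
    unfolding U_def U'_def w_def by (simp_all add: adj_simps sa mult.assoc zero)
  have U_v: "c \<in> alg_spectrum U \<longleftrightarrow> c \<in> alg_spectrum (v * adj v)" if "c \<noteq> 0" for c
  proof -
    \<comment> \<open>As \<open>p\<close> commutes with \<open>r\<close> and
      \<open>s * q * s = q * q\<close>, a factor \<open>r\<close> can be split off in front and
      moved to the other end.\<close>
    have "U = r * (p * z * q * q * adj z * r)"
      unfolding U_def w_def by (simp add: adj_simps sa mult.assoc flip: r(2) s(2))
    moreover have "(p * z * q * q * adj z * r) * r = v * adj v"
      unfolding v_def by (simp add: adj_simps sa mult.assoc r(2))
    ultimately show ?thesis using alg_spectrum_mult_commute[OF that] by metis
  qed
  have orthv: "(v * adj v) * (adj v * v) = 0" "(adj v * v) * (v * adj v) = 0"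
    unfolding v_def by (simp_all add: adj_simps sa mult.assoc zero)
  \<comment> \<open>The squares of \<open>v\<close> and \<open>adj v\<close> vanish because
    \<open>p\<close> and \<open>q\<close> are orthogonal.\<close>
  have sqv: "(v + adj v) * (v + adj v) = v * adj v + adj v * v"
    unfolding v_def by (simp add: adj_simps sa algebra_simps zero)
  have "alg_spectrum (v * adj v) \<subseteq> {0}"
  proof
    fix c assume c: "c \<in> alg_spectrum (v * adj v)"
    show "c \<in> {0}"
    proof (rule ccontr)
      assume "c \<notin> {0}"
      then have nz: "c \<noteq> 0" by simp
      have "c \<in> alg_spectrum ((v + adj v) * (v + adj v))"
        unfolding sqv using alg_spectrum_add_orthogonal[OF orthv nz] c by blast
      moreover have "positive_elem ((v + adj v) * (v + adj v))"
        by (intro positive_elem_square) (simp add: self_adjoint_def adj_simps add.commute)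
      ultimately have "0 \<le> Re c" "Im c = 0" by (auto elim: positive_elem_spectrum)
      \<comment> \<open>The opposite sign comes from \<open>U\<close>: \<open>- c\<close> lies in
        the spectrum of the square of \<open>x * y\<close>, an element with real spectrum by
        assumption.\<close>
      have "c \<in> alg_spectrum (U + U')"
        using alg_spectrum_add_orthogonal[OF orthU nz] U_v[OF nz] c by blast
      then have "- c \<in> alg_spectrum ((x * y) * (x * y))"
        unfolding sqs alg_spectrum_minus by simp
      then have "- c \<in> complex_of_real ` {0..}"
        using alg_spectrum_square_nonneg[OF assms(2)[OF y]] by blast
      then have "Re (- c) \<ge> 0" by (metis Re_complex_of_real atLeast_iff imageE)
      with \<open>0 \<le> Re c\<close> \<open>Im c = 0\<close> nz show False by (simp add: complex_eq_iff)
    qed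
  qed
  then have "v * adj v = 0"
    by (intro self_adjoint_eq_zero_if_spectrum) (simp add: self_adjoint_def adj_simps)
  then show ?thesis
    unfolding v_def[symmetric] by (metis adj_adj adj_mult_self_eq_zero adj_zero)
qed

theorem lemma3:
  fixes x :: "'a::unital_cstar_algebra"
  assumes "self_adjoint x"
  shows "(\<forall>y::'a. self_adjoint y \<longrightarrow> alg_spectrum (x * y) \<subseteq> \<real>) \<longleftrightarrow>
         (\<forall>y::'a. pos_part x * y * neg_part x = 0)"
  using pos_mult_neg_eq_zero[OF pos_neg_decomp_parts[OF assms]]
    alg_spectrum_mult_real[OF pos_neg_decomp_parts[OF assms]] by blast

end
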